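(* Let $p$ be a prime, let $n\ge 1$, and let $\alpha_1,\alpha_2,\dots,\alpha_n,\beta\ge 1$ be integers. Put $\alpha_{\max}:=\max_{1\le j\le n}\alpha_j$. Then the nilpotency degree $\nu$ of the augmentation ideal of the group ring $\mathbb{Z}_{p^\beta}[\mathbb{Z}_{p^{\alpha_1}}\times\mathbb{Z}_{p^{\alpha_2}}\times\dots\times\mathbb{Z}_{p^{\alpha_n}}]$ is $$\nu\ =\ \sum_{j=1}^n p^{\alpha_j}-n+1+(\beta-1)(p-1)p^{\alpha_{\max}-1}.$$
   Context: Here $\mathbb{Z}_q=\mathbb{Z}/q\mathbb{Z}$. The group ring $R[A]$ has coefficient ring $R=\mathbb{Z}_{p^\beta}$ and (additively written) group $A=\mathbb{Z}_{p^{\alpha_1}}\times\dots\times\mathbb{Z}_{p^{\alpha_n}}$. Its augmentation ideal $I$ is the kernel of the ring homomorphism $R[A]\to R$ that sends an element to the sum of its coefficients. The nilpotency degree of $I$ is the smallest integer $\nu\ge 1$ with $I^\nu=0$. *)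

theory Defs
  imports "HOL-Algebra.Algebra" "HOL-Number_Theory.Number_Theory"
begin

definition gr_support :: "('r, 'm) ring_scheme \<Rightarrow> ('g, 'k) monoid_scheme \<Rightarrow> ('g \<Rightarrow> 'r) \<Rightarrow> 'g set"
  where "gr_support R A f = {g \<in> carrier A. f g \<noteq> \<zero>\<^bsub>R\<^esub>}"

text \<open>
  An element of the group ring is its coefficient function \<^term>\<open>f\<close>, standing for the formal sum of
  the \<open>f g \<cdot> g\<close>. Coefficient functions are extensional outside \<^term>\<open>carrier A\<close>, so that equality of
  elements is equality of functions. The group \<^term>\<open>A\<close> is written multiplicatively, as always in
  HOL-Algebra.
\<close>

definition group_ring ::
    "('r, 'm) ring_scheme \<Rightarrow> ('g, 'k) monoid_scheme \<Rightarrow> ('g \<Rightarrow> 'r) ring"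
  where "group_ring R A =
    \<lparr>carrier = {f \<in> carrier A \<rightarrow>\<^sub>E carrier R. finite (gr_support R A f)},
     monoid.mult = (\<lambda>f h. \<lambda>g\<in>carrier A.
       \<Oplus>\<^bsub>R\<^esub> x \<in> gr_support R A f. f x \<otimes>\<^bsub>R\<^esub> h (inv\<^bsub>A\<^esub> x \<otimes>\<^bsub>A\<^esub> g)),
     monoid.one = (\<lambda>g\<in>carrier A. if g = \<one>\<^bsub>A\<^esub> then \<one>\<^bsub>R\<^esub> else \<zero>\<^bsub>R\<^esub>),
     ring.zero = (\<lambda>g\<in>carrier A. \<zero>\<^bsub>R\<^esub>),
     ring.add = (\<lambda>f h. \<lambda>g\<in>carrier A. f g \<oplus>\<^bsub>R\<^esub> h g)\<rparr>"

definition augmentation ::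
    "('r, 'm) ring_scheme \<Rightarrow> ('g, 'k) monoid_scheme \<Rightarrow> ('g \<Rightarrow> 'r) \<Rightarrow> 'r"
  where "augmentation R A f = (\<Oplus>\<^bsub>R\<^esub> g \<in> gr_support R A f. f g)"

definition augmentation_ideal ::
    "('r, 'm) ring_scheme \<Rightarrow> ('g, 'k) monoid_scheme \<Rightarrow> ('g \<Rightarrow> 'r) set"
  where "augmentation_ideal R A = a_kernel (group_ring R A) R (augmentation R A)"

text \<open>
  A relation rather than a \<open>LEAST\<close> term, so that it also asserts that some power vanishes.
  Powers are taken in the monoid of ideals, whose multiplication is \<^const>\<open>ideal_prod\<close>.
\<close>

definition is_nilpotency_degree :: "('a, 'm) ring_scheme \<Rightarrow> 'a set \<Rightarrow> nat \<Rightarrow> bool"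
  where "is_nilpotency_degree S I \<nu> \<longleftrightarrow>
    1 \<le> \<nu> \<and> I [^]\<^bsub>ideals_set S\<^esub> \<nu> = {\<zero>\<^bsub>S\<^esub>} \<and>
    (\<forall>m. 1 \<le> m \<and> I [^]\<^bsub>ideals_set S\<^esub> m = {\<zero>\<^bsub>S\<^esub>} \<longrightarrow> \<nu> \<le> m)"

end

theory Submission
  imports Defs "HOL-Library.Function_Algebras" "HOL-Library.Poly_Mapping"
begin

text \<open>
  The group ring is the quotient of the polynomial ring in variables \<open>x j\<close> over the integers by
  \<open>p ^ \<beta>\<close> and the \<open>x j ^ (p ^ \<alpha> j) - 1\<close>, and \<open>I\<close> is generated by the \<open>y j = x j - 1\<close>. So \<open>I ^ m\<close>
  vanishes exactly when all monomials of degree \<open>m\<close> in the \<open>y j\<close> do. The question becomes: what is the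
  largest degree of a monomial in the \<open>y j\<close> that is not zero?

  Upper bound. Give each \<open>y j\<close> weight 1 and give \<open>p\<close> weight \<open>w = (p - 1) * p ^ (\<alpha>max - 1)\<close>. Expanding
  \<open>(1 + y j) ^ (p ^ \<alpha> j) = 1\<close> rewrites \<open>y j ^ (p ^ \<alpha> j)\<close> as a combination of smaller powers of \<open>y j\<close>
  whose coefficients are binomials divisible by \<open>p\<close>, and the \<open>p\<close>-adic valuation of these binomials is
  large enough that the rewriting never decreases the weight (\<open>prime_power_binomial\<close>). It terminates
  because \<open>p ^ \<beta> = 0\<close>. What survives has a factor \<open>p ^ k\<close> with \<open>k < \<beta>\<close> and exponents below \<open>p ^ \<alpha> j\<close>,
  hence weight at most \<open>N = (\<Sum>j. p ^ \<alpha> j - 1) + (\<beta> - 1) * w\<close>. Everything heavier is zero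
  (\<open>monomial_vanishes\<close>).

  Lower bound. Let \<open>\<alpha> j\<close> be maximal and put \<open>v = x j ^ p ^ (\<alpha> j - 1) - 1\<close>. Then \<open>v\<close> differs from
  \<open>y j ^ p ^ (\<alpha> j - 1)\<close> by heavier terms only, which the upper bound kills in degree \<open>N\<close>. On the other
  hand \<open>(1 + v) ^ p = 1\<close> says that \<open>v ^ p\<close> is \<open>p * v\<close> times \<open>- 1 + v * r\<close>, so \<open>\<beta> - 1\<close> blocks of \<open>p - 1\<close>
  factors \<open>v\<close> turn into \<open>p ^ (\<beta> - 1)\<close>. The monomial of degree \<open>N\<close> with the excess exponent at \<open>j\<close> is thus
  \<open>p ^ (\<beta> - 1) * (\<Prod>j. y j ^ (p ^ \<alpha> j - 1))\<close> up to sign (\<open>leading_monomial_reduces\<close>). Since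
  \<open>y j ^ (p ^ \<alpha> j - 1)\<close> is the sum of all powers of \<open>x j\<close> modulo \<open>p\<close>, this is \<open>p ^ (\<beta> - 1)\<close> times the sum
  of all group elements (\<open>norm_element_equ\<close>), which is not zero.

  The algebra is done for congruences modulo an ideal \<open>K\<close> of a commutative ring. It is
  transported along a surjection from the integral monoid ring of \<open>nat \<Rightarrow> nat\<close> onto the group
  ring (\<open>group_ring_cover\<close>), with \<open>K\<close> its kernel.
\<close>

section \<open>Binomial coefficients of prime powers\<close>

text \<open>
  The difference \<open>p ^ a - p ^ v\<close> is a sum of \<open>a - v\<close> terms \<open>(p - 1) * p ^ t\<close> with \<open>t < a\<close>; each is at
  most the last one.
\<close>

lemma prime_power_le_telescope:
  fixes p :: nat
  assumes "p \<ge> 1" "v < a"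
  shows "p ^ a \<le> p ^ v + (a - v) * ((p - 1) * p ^ (a - 1))"
  using assms(2)
proof (induction a)
  case (Suc a)
  have step: "p ^ Suc a = p ^ a + (p - 1) * p ^ a"
    using assms(1) by (cases p) auto
  show ?case
  proof (cases "v = a")
    case True
    then show ?thesis using step by simp
  next
    case False
    then have "v < a" using Suc.prems by simp
    have "p ^ a \<le> p ^ v + (a - v) * ((p - 1) * p ^ (a - 1))" using Suc.IH \<open>v < a\<close> by simp
    also have "\<dots> \<le> p ^ v + (a - v) * ((p - 1) * p ^ a)"
      using assms(1) by (intro add_left_mono mult_left_mono power_increasing) auto
    finally have "p ^ Suc a \<le> p ^ v + ((a - v) * ((p - 1) * p ^ a) + (p - 1) * p ^ a)"
      using step by simp
    also have "(a - v) * ((p - 1) * p ^ a) + (p - 1) * p ^ a = (Suc a - v) * ((p - 1) * p ^ a)"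
      using \<open>v < a\<close> by (simp add: Suc_diff_le)
    finally show ?thesis by simp
  qed
qed simp

text \<open>
  For \<open>i\<close> of \<open>p\<close>-adic valuation \<open>v\<close> take \<open>c = a - v\<close>. The last conclusion says that replacing
  \<open>y ^ (p ^ a)\<close> by \<open>p ^ c * y ^ i\<close> does not decrease the weight when \<open>p\<close> weighs \<open>(p - 1) * p ^ (a - 1)\<close>.
\<close>

lemma prime_power_binomial:
  fixes p :: nat
  assumes "Factorial_Ring.prime p" "0 < i" "i < p ^ a"
  obtains c where "1 \<le> c" "p ^ c dvd (p ^ a) choose i" "p ^ a \<le> i + c * ((p - 1) * p ^ (a - 1))"
proof -
  obtain v i' where i: "i = p ^ v * i'" and ndvd: "\<not> p dvd i'"
    using assms(1,2) by (metis multiplicity_decompose' neq0_conv not_prime_unit)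
  have v: "v < a"
  proof (rule ccontr)
    assume "\<not> v < a"
    then have "p ^ a \<le> p ^ v" using prime_ge_1_nat[OF assms(1)] by (intro power_increasing) simp_all
    moreover have "p ^ v \<le> i" using i assms(2) by simp
    ultimately show False using assms(3) by simp
  qed
  have "i * ((p ^ a) choose i) = p ^ a * ((p ^ a - 1) choose (i - 1))"
    using assms(2) by (simp add: times_binomial_minus1_eq)
  then have "p ^ v * (i' * ((p ^ a) choose i)) = p ^ v * (p ^ (a - v) * ((p ^ a - 1) choose (i - 1)))"
    using v i by (simp add: mult.assoc[symmetric] power_add[symmetric])
  then have "i' * ((p ^ a) choose i) = p ^ (a - v) * ((p ^ a - 1) choose (i - 1))"
    using prime_gt_0_nat[OF assms(1)] by simp
  then have "p ^ (a - v) dvd i' * ((p ^ a) choose i)" by simp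
  moreover have "coprime (p ^ (a - v)) i'"
    using assms(1) ndvd by (simp add: prime_imp_coprime)
  ultimately have "p ^ (a - v) dvd (p ^ a) choose i"
    by (simp add: coprime_dvd_mult_right_iff)
  moreover have "p ^ a \<le> i + (a - v) * ((p - 1) * p ^ (a - 1))"
  proof -
    have "p ^ a \<le> p ^ v + (a - v) * ((p - 1) * p ^ (a - 1))"
      using prime_power_le_telescope[OF prime_ge_1_nat[OF assms(1)] v] .
    moreover have "p ^ v \<le> i" using i assms(2) by simp
    ultimately show ?thesis by linarith
  qed
  ultimately show thesis using that[of "a - v"] v by simp
qed

lemma prime_dvd_prime_power_binomial:
  fixes p :: nat
  assumes "Factorial_Ring.prime p" "0 < i" "i < p ^ a"
  shows "p dvd (p ^ a) choose i"
  using prime_power_binomial[OF assms] by (metis One_nat_def Suc_le_lessD dvd_power dvd_trans)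

lemma of_nat_dvd_of_nat: "m dvd n \<Longrightarrow> (of_nat m :: 'a::comm_semiring_1) dvd of_nat n"
  by (auto simp: dvd_def)

lemma freshman_shifted:
  fixes y :: "'a::comm_ring_1"
  assumes "Factorial_Ring.prime p"
  obtains s where "(1 + y) ^ (p ^ a) - 1 = y ^ (p ^ a) + of_nat p * (y * s)"
proof -
  have q: "p ^ a \<ge> 1" using prime_gt_0_nat[OF assms] by simp
  have "of_nat p * y dvd (\<Sum>i\<in>{0<..<p ^ a}. of_nat ((p ^ a) choose i) * y ^ i)"
    using prime_dvd_prime_power_binomial[OF assms]
    by (intro dvd_sum mult_dvd_mono of_nat_dvd_of_nat) (auto intro: dvd_power)
  then obtain s where s: "(\<Sum>i\<in>{0<..<p ^ a}. of_nat ((p ^ a) choose i) * y ^ i) = of_nat p * y * s"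
    by (auto simp: dvd_def)
  have "{..p ^ a} = insert 0 (insert (p ^ a) {0<..<p ^ a})" using q by auto
  then have "(1 + y) ^ (p ^ a) = 1 + (y ^ (p ^ a) + of_nat p * y * s)"
    using prime_gt_0_nat[OF assms] q s by (subst add.commute, subst binomial_ring) simp
  then show thesis using that[of s] by (simp add: mult.assoc)
qed

text \<open>
  If \<open>(1 + v) ^ p = 1\<close>, this expresses \<open>v ^ p\<close> as \<open>p * v\<close> times the unit-like factor \<open>v * r - 1\<close>,
  which trades \<open>p - 1\<close> factors \<open>v\<close> for one factor \<open>p\<close>.
\<close>

lemma prime_power_expansion:
  fixes v :: "'a::comm_ring_1"
  assumes "Factorial_Ring.prime p"
  obtains r where "(1 + v) ^ p = 1 + v ^ p - of_nat p * v * (v * r - 1)"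
proof -
  have p2: "p \<ge> 2" using assms by (simp add: prime_ge_2_nat)
  have "of_nat p * (v * v) dvd (\<Sum>i\<in>{1<..<p}. of_nat (p choose i) * v ^ i)"
  proof (intro dvd_sum mult_dvd_mono of_nat_dvd_of_nat)
    fix i assume i: "i \<in> {1<..<p}"
    then show "p dvd p choose i"
      using prime_dvd_prime_power_binomial[OF assms, of i 1] by simp
    show "v * v dvd v ^ i" 
      using i le_imp_power_dvd[of 2 i v] by (simp add: power2_eq_square)
  qed
  then obtain r where r: "(\<Sum>i\<in>{1<..<p}. of_nat (p choose i) * v ^ i) = of_nat p * (v * v) * r"
    by (auto simp: dvd_def)
  have "{..p} = insert 0 (insert 1 (insert p {1<..<p}))" using p2 by auto
  then have "(1 + v) ^ p = 1 + (of_nat p * v + (v ^ p + of_nat p * (v * v) * r))"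
    using p2 r by (simp add: binomial_ring[of v 1] add.commute[of 1 v])
  then show thesis using that[of "- r"] by (simp add: algebra_simps)
qed

lemma sum_powers_shifted:
  fixes y :: "'a::comm_ring_1"
  shows "(\<Sum>i<q. (1 + y) ^ i) = (\<Sum>k<q. of_nat (q choose Suc k) * y ^ k)"
proof (induction q)
  case (Suc q)
  have "(1 + y) ^ q = (\<Sum>k<Suc q. of_nat (q choose k) * y ^ k)"
    by (simp add: binomial_ring[of y 1] add.commute[of 1 y] lessThan_Suc_atMost)
  then show ?case using Suc
    by (simp add: algebra_simps sum.distrib binomial_eq_0)
qed simp

text \<open>
  Both sides agree because \<open>\<Sum>i<q. x ^ i = ((1 + y) ^ q - 1) / y\<close> for \<open>x = 1 + y\<close>, and the inner binomials
  vanish modulo \<open>p\<close>. The division by \<open>y\<close> is not available in a general ring, hence the detour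
  through \<open>sum_powers_shifted\<close>.
\<close>

lemma norm_element_eq_power:
  fixes y :: "'a::comm_ring_1"
  assumes "Factorial_Ring.prime p"
  obtains t where "(\<Sum>i<p ^ a. (1 + y) ^ i) = y ^ (p ^ a - 1) + of_nat p * t"
proof -
  obtain q where q: "p ^ a = Suc q"
    using assms by (metis not0_implies_Suc power_not_zero not_prime_0)
  have "of_nat p dvd (\<Sum>k<q. of_nat ((p ^ a) choose Suc k) * y ^ k)"
    using prime_dvd_prime_power_binomial[OF assms, of _ a] q
    by (intro dvd_sum dvd_mult2 of_nat_dvd_of_nat) (auto simp del: binomial_Suc_Suc)
  then obtain t where "(\<Sum>k<q. of_nat ((p ^ a) choose Suc k) * y ^ k) = of_nat p * t"
    by (rule dvdE)
  then have "(\<Sum>i<p ^ a. (1 + y) ^ i) = y ^ (p ^ a - 1) + of_nat p * t"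
    unfolding sum_powers_shifted q by (simp del: binomial_Suc_Suc)
  then show thesis by (rule that)
qed

section \<open>Congruence modulo an ideal\<close>

locale ring_congruence =
  fixes K :: "'a::comm_ring_1 set"
  assumes K_zero: "0 \<in> K"
    and K_add: "x \<in> K \<Longrightarrow> z \<in> K \<Longrightarrow> x + z \<in> K"
    and K_mult: "x \<in> K \<Longrightarrow> r * x \<in> K"
begin

definition equ :: "'a \<Rightarrow> 'a \<Rightarrow> bool" (infix \<open>\<asymp>\<close> 50)
  where "x \<asymp> z \<longleftrightarrow> x - z \<in> K"

lemma K_uminus: "x \<in> K \<Longrightarrow> - x \<in> K"
  using K_mult[of x "-1"] by simp

lemma K_diff: "x \<in> K \<Longrightarrow> z \<in> K \<Longrightarrow> x - z \<in> K"
  using K_add[OF _ K_uminus] by simp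

lemma K_mult_right: "x \<in> K \<Longrightarrow> x * r \<in> K"
  using K_mult[of x r] by (simp add: mult.commute)

lemma K_sum: "(\<And>i. i \<in> B \<Longrightarrow> f i \<in> K) \<Longrightarrow> sum f B \<in> K"
  by (induction B rule: infinite_finite_induct) (auto intro: K_zero K_add)

lemma equ_refl [simp]: "x \<asymp> x"
  by (simp add: equ_def K_zero)

lemma equ_sym: "x \<asymp> z \<Longrightarrow> z \<asymp> x"
  using K_uminus[of "x - z"] by (simp add: equ_def)

lemma equ_trans [trans]: "x \<asymp> z \<Longrightarrow> z \<asymp> u \<Longrightarrow> x \<asymp> u"
  using K_add[of "x - z" "z - u"] by (simp add: equ_def)

lemma equ_mult_left: "x \<asymp> z \<Longrightarrow> r * x \<asymp> r * z"
  using K_mult[of "x - z" r] by (simp add: equ_def algebra_simps)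

lemma equ_mult_right: "x \<asymp> z \<Longrightarrow> x * r \<asymp> z * r"
  using equ_mult_left[of x z r] by (simp add: mult.commute)

lemma equ_K: "x \<asymp> z \<Longrightarrow> x \<in> K \<longleftrightarrow> z \<in> K"
  by (metis K_add K_uminus add_diff_cancel_left' diff_add_cancel equ_def uminus_add_conv_diff)

end

section \<open>The weight filtration\<close>

locale prime_power_relations = ring_congruence K for K :: "'a::comm_ring_1 set" +
  fixes p \<beta> w :: nat and J :: "'i set" and \<alpha> :: "'i \<Rightarrow> nat" and y :: "'i \<Rightarrow> 'a"
  assumes prime: "Factorial_Ring.prime p"
    and finite_J: "finite J"
    and char: "of_nat p ^ \<beta> \<in> K"
    and order: "j \<in> J \<Longrightarrow> (1 + y j) ^ (p ^ \<alpha> j) \<asymp> 1"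
    and weight: "j \<in> J \<Longrightarrow> (p - 1) * p ^ (\<alpha> j - 1) \<le> w"
begin

lemma char_ge: "\<beta> \<le> k \<Longrightarrow> of_nat p ^ k * x \<in> K"
  using K_mult_right[OF K_mult[OF char, of "of_nat p ^ (k - \<beta>)"], of x]
  by (simp add: power_add[symmetric])

lemma prod_update:
  fixes e :: "'i \<Rightarrow> nat"
  assumes "j \<in> J"
  shows "(\<Prod>i\<in>J. y i ^ (e(j := l)) i) = y j ^ l * (\<Prod>i\<in>J - {j}. y i ^ e i)"
    and "(\<Sum>i\<in>J. (e(j := l)) i) = l + (\<Sum>i\<in>J - {j}. e i)"
proof -
  show "(\<Prod>i\<in>J. y i ^ (e(j := l)) i) = y j ^ l * (\<Prod>i\<in>J - {j}. y i ^ e i)"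
    unfolding prod.remove[OF finite_J assms] by (auto intro!: prod.cong)
  show "(\<Sum>i\<in>J. (e(j := l)) i) = l + (\<Sum>i\<in>J - {j}. e i)"
    unfolding sum.remove[OF finite_J assms] by (auto intro!: sum.cong)
qed

text \<open>
  The induction is on the number \<open>\<beta> - k\<close> of factors \<open>p\<close> still needed to reach zero: an exponent that
  is too large is lowered with the relation for \<open>(1 + y j) ^ (p ^ \<alpha> j)\<close>, which keeps the weight and
  produces at least one new factor \<open>p\<close>.
\<close>

lemma monomial_vanishes:
  assumes "(\<Sum>j\<in>J. p ^ \<alpha> j - 1) + (\<beta> - 1) * w < k * w + (\<Sum>j\<in>J. e j)"
  shows "of_nat p ^ k * (\<Prod>j\<in>J. y j ^ e j) \<in> K"
  using assms
proof (induction "\<beta> - k" arbitrary: k e rule: less_induct)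
  case less
  show ?case
  proof (cases "\<beta> \<le> k")
    case True
    then show ?thesis by (rule char_ge)
  next
    case False
    then have "k * w \<le> (\<beta> - 1) * w" by (intro mult_right_mono) auto
    then have "\<not> (\<Sum>j\<in>J. e j) \<le> (\<Sum>j\<in>J. p ^ \<alpha> j - 1)" using less.prems by linarith
    then obtain j where j: "j \<in> J" and "\<not> e j \<le> p ^ \<alpha> j - 1"
      using sum_mono[of J e "\<lambda>j. p ^ \<alpha> j - 1"] by blast
    then have ej: "p ^ \<alpha> j \<le> e j" by simp
    define q where "q = p ^ \<alpha> j"
    have q1: "q \<ge> 1" using prime_gt_0_nat[OF prime] by (simp add: q_def)
    define T where "T = of_nat p ^ k * (y j ^ (e j - q) * (\<Prod>i\<in>J - {j}. y i ^ e i))"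
    have "of_nat p ^ k * (\<Prod>j\<in>J. y j ^ e j) = T * y j ^ q"
    proof -
      have "y j ^ e j = y j ^ (e j - q) * y j ^ q"
        using ej by (simp add: q_def power_add[symmetric])
      then show ?thesis
        by (simp add: T_def prod.remove[OF finite_J j] algebra_simps)
    qed
    also have "\<dots> = T * ((1 + y j) ^ q - 1)
        - (\<Sum>i\<in>{0<..<q}. T * (of_nat (q choose i) * y j ^ i))"
    proof -
      have "{..q} = insert 0 (insert q {0<..<q})" using q1 by auto
      then have "(1 + y j) ^ q = 1 + (y j ^ q + (\<Sum>i\<in>{0<..<q}. of_nat (q choose i) * y j ^ i))"
        using q1 by (simp add: binomial_ring[of "y j" 1] add.commute[of 1 "y j"])
      then have "y j ^ q = ((1 + y j) ^ q - 1) - (\<Sum>i\<in>{0<..<q}. of_nat (q choose i) * y j ^ i)"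
        by simp
      then show ?thesis by (simp only: right_diff_distrib sum_distrib_left)
    qed
    also have "\<dots> \<in> K"
    proof -
      have "T * (of_nat (q choose i) * y j ^ i) \<in> K" if i: "i \<in> {0<..<q}" for i
      proof -
        from i have "0 < i" "i < p ^ \<alpha> j" by (auto simp: q_def)
        then obtain c where c: "1 \<le> c" "p ^ c dvd q choose i"
            "q \<le> i + c * ((p - 1) * p ^ (\<alpha> j - 1))"
          using prime_power_binomial[OF prime] unfolding q_def by blast
        then obtain d where d: "q choose i = p ^ c * d" by (auto simp: dvd_def)
        let ?e = "e(j := e j - q + i)"
        have "c * ((p - 1) * p ^ (\<alpha> j - 1)) \<le> c * w" using weight[OF j] by simp
        then have "q \<le> i + c * w" using c(3) by linarith
        moreover have "(\<Sum>i\<in>J. e i) = e j + (\<Sum>i\<in>J - {j}. e i)"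
          by (rule sum.remove[OF finite_J j])
        ultimately have "k * w + (\<Sum>i\<in>J. e i) \<le> (k + c) * w + (\<Sum>i\<in>J. ?e i)"
          using ej prod_update(2)[OF j, of e "e j - q + i"] by (simp add: q_def algebra_simps)
        then have "of_nat p ^ (k + c) * (\<Prod>i\<in>J. y i ^ ?e i) \<in> K"
          using less.prems False c(1) by (intro less.hyps) auto
        then have "of_nat d * (of_nat p ^ (k + c) * (\<Prod>i\<in>J. y i ^ ?e i)) \<in> K"
          by (rule K_mult)
        also have "of_nat d * (of_nat p ^ (k + c) * (\<Prod>i\<in>J. y i ^ ?e i))
            = T * (of_nat (q choose i) * y j ^ i)"
          unfolding prod_update(1)[OF j] by (simp add: T_def d power_add algebra_simps)
        finally show ?thesis .
      qed
      moreover have "T * ((1 + y j) ^ q - 1) \<in> K"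
        using order[OF j] by (auto simp: equ_def q_def intro: K_mult)
      ultimately show ?thesis
        by (auto intro!: K_diff K_sum)
    qed
    finally show ?thesis .
  qed
qed

text \<open>
  The monomial on the left has the largest weight that \<open>monomial_vanishes\<close> does not rule out.
  Replacing \<open>y j ^ m\<close> by \<open>v\<close> in it therefore changes nothing, and powers of \<open>v\<close> can be traded for
  powers of \<open>p\<close> exactly, whereas powers of \<open>y j\<close> only up to heavier terms.
\<close>

lemma leading_monomial_reduces:
  assumes "j \<in> J" "\<alpha> j \<ge> 1" "\<beta> \<ge> 1" and w: "w = (p - 1) * p ^ (\<alpha> j - 1)"
  shows "y j ^ (p ^ \<alpha> j - 1 + (\<beta> - 1) * w) * (\<Prod>i\<in>J - {j}. y i ^ (p ^ \<alpha> i - 1)) \<asymp>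
    (-1) ^ (\<beta> - 1) * (of_nat p ^ (\<beta> - 1) * (\<Prod>i\<in>J. y i ^ (p ^ \<alpha> i - 1)))"
proof -
  define m q B Y M where "m = p ^ (\<alpha> j - 1)" and "q = p ^ \<alpha> j" and "B = \<beta> - 1"
    and "Y = (\<Prod>i\<in>J - {j}. y i ^ (p ^ \<alpha> i - 1))" and "M = (B + 1) * (p - 1)"
  define v where "v = (1 + y j) ^ m - 1"
  let ?P = "of_nat p :: 'a"
  have p2: "p \<ge> 2" using prime by (rule prime_ge_2_nat)
  have m1: "m \<ge> 1" using p2 by (simp add: m_def)
  have q: "q = p * m" using assms(2) by (simp add: q_def m_def power_eq_if)
  have q': "q = w + m" using p2 w by (cases p) (auto simp: q m_def)
  have wm: "m \<le> w" using p2 by (simp add: w m_def)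
  have mM: "m * M = w + B * w" by (simp add: M_def w m_def distrib_left distrib_right mult_ac)
  obtain s where s: "v = y j ^ m + ?P * (y j * s)"
    using freshman_shifted[OF prime] unfolding v_def m_def by blast
  \<comment> \<open>The exponent on the right is \<open>m - 1 + m * M\<close>; in the expansion of \<open>v ^ M\<close> each exchange of
    \<open>y j ^ m\<close> for \<open>p * y j * s\<close> raises the weight by at least \<open>w + 1 - m > 0\<close>.\<close>
  have step1: "y j ^ (m - 1) * v ^ M * Y \<asymp> y j ^ (q - 1 + B * w) * Y"
  proof -
    have tail: "of_nat (M choose i) * (?P * (y j * s)) ^ i * (y j ^ m) ^ (M - i) * (y j ^ (m - 1) * Y) \<in> K"
      if i: "i \<in> {1..M}" for i
    proof -
      let ?l = "i + m * (M - i) + (m - 1)"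
      have "m * (M - i) + m * i = m * M" using i by (simp add: algebra_simps)
      moreover have "m * i \<le> i * w" using wm by simp
      moreover have "0 < i" using i by simp
      ultimately have "w + m + B * w < i * w + (i + m * (M - i) + m)"
        unfolding mM by linarith
      then have "q - 1 + B * w < i * w + ?l" using m1 q' by linarith
      moreover have "(\<Sum>i\<in>J. p ^ \<alpha> i - 1) = (q - 1) + (\<Sum>i\<in>J - {j}. p ^ \<alpha> i - 1)"
        unfolding q_def by (rule sum.remove[OF finite_J assms(1)])
      ultimately have "?P ^ i * (\<Prod>a\<in>J. y a ^ ((\<lambda>a. p ^ \<alpha> a - 1)(j := ?l)) a) \<in> K"
        by (intro monomial_vanishes, unfold prod_update(2)[OF assms(1)]) (simp add: B_def)
      then have "of_nat (M choose i) * s ^ i * (?P ^ i * (y j ^ ?l * Y)) \<in> K"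
        unfolding prod_update(1)[OF assms(1)] Y_def[symmetric] by (rule K_mult)
      then show ?thesis
        by (simp add: power_add power_mult power_mult_distrib mult_ac)
    qed
    have "{..M} = insert 0 {1..M}" by auto
    then have "v ^ M = y j ^ (m * M)
        + (\<Sum>i\<in>{1..M}. of_nat (M choose i) * (?P * (y j * s)) ^ i * (y j ^ m) ^ (M - i))"
      unfolding s by (subst add.commute, subst binomial_ring) (simp add: power_mult)
    then have "y j ^ (m - 1) * v ^ M * Y - y j ^ (m - 1 + m * M) * Y = (\<Sum>i\<in>{1..M}.
        of_nat (M choose i) * (?P * (y j * s)) ^ i * (y j ^ m) ^ (M - i) * (y j ^ (m - 1) * Y))"
      by (simp add: algebra_simps power_add sum_distrib_right sum_distrib_left)
    moreover have "m - 1 + m * M = q - 1 + B * w" using m1 mM q' by simp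
    ultimately show ?thesis unfolding equ_def using tail by (auto intro: K_sum)
  qed
  obtain r where r: "(1 + v) ^ p = 1 + v ^ p - ?P * v * (v * r - 1)"
    using prime_power_expansion[OF prime] by blast
  have step2: "v ^ p \<asymp> ?P * v * (v * r - 1)"
  proof -
    have "(1 + v) ^ p \<asymp> 1"
      using order[OF assms(1)] unfolding v_def
      by (simp add: power_mult[symmetric] q_def[symmetric] q mult.commute)
    then show ?thesis unfolding r equ_def by simp
  qed
  have step3: "v ^ ((k + 1) * (p - 1)) \<asymp> ?P ^ k * v ^ (p - 1) * (v * r - 1) ^ k" for k
  proof (induction k)
    case (Suc k)
    have "v ^ ((Suc k + 1) * (p - 1)) = v ^ ((k + 1) * (p - 1)) * v ^ (p - 1)"
    proof -
      have "(Suc k + 1) * (p - 1) = (k + 1) * (p - 1) + (p - 1)"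
        using distrib_right[of "k + 1" 1 "p - 1"] by (simp only: Suc_eq_plus1 mult_1)
      then show ?thesis by (simp only: power_add)
    qed
    also have "\<dots> \<asymp> ?P ^ k * v ^ (p - 1) * (v * r - 1) ^ k * v ^ (p - 1)"
      using Suc by (rule equ_mult_right)
    also have "\<dots> = ?P ^ k * v ^ (p - 2) * (v * r - 1) ^ k * v ^ p"
    proof -
      have "(p - 1) + (p - 1) = (p - 2) + p" using p2 by simp
      then have vv: "v ^ (p - 1) * v ^ (p - 1) = v ^ (p - 2) * v ^ p"
        by (simp only: power_add[symmetric])
      have "?P ^ k * v ^ (p - 1) * (v * r - 1) ^ k * v ^ (p - 1) =
          ?P ^ k * (v * r - 1) ^ k * (v ^ (p - 1) * v ^ (p - 1))"
        by (simp only: mult_ac)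
      then show ?thesis unfolding vv by (simp only: mult_ac)
    qed
    also have "\<dots> \<asymp> ?P ^ k * v ^ (p - 2) * (v * r - 1) ^ k * (?P * v * (v * r - 1))"
      using step2 by (rule equ_mult_left)
    also have "\<dots> = ?P ^ Suc k * v ^ (p - 1) * (v * r - 1) ^ Suc k"
    proof -
      have "p - 1 = Suc (p - 2)" using p2 by simp
      then have "v ^ (p - 1) = v ^ (p - 2) * v" by simp
      then show ?thesis by (simp only: power_Suc mult_ac)
    qed
    finally show ?case .
  qed simp
  define Z where "Z = ?P ^ B * v ^ (p - 1)"
  \<comment> \<open>So \<open>Z\<close> is annihilated by \<open>v\<close>, and the factors \<open>v * r - 1\<close> act on it as \<open>-1\<close>.\<close>
  have step4: "Z * v \<in> K"
  proof -
    have "p = Suc (p - 1)" using p2 by simp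
    then have "v ^ p = v ^ (p - 1) * v" by (metis power_Suc2)
    then have "Z * v = ?P ^ B * v ^ p" by (simp add: Z_def mult_ac)
    also have "\<dots> \<asymp> ?P ^ B * (?P * v * (v * r - 1))" using step2 by (rule equ_mult_left)
    finally have "Z * v \<asymp> ?P ^ \<beta> * (v * (v * r - 1))"
      using assms(3) by (simp add: B_def power_eq_if mult_ac)
    then show ?thesis using equ_K char_ge by blast
  qed
  have step5: "Z * (v * r - 1) ^ k \<asymp> (-1) ^ k * Z" for k
  proof (induction k)
    case (Suc k)
    have "(Z * (v * r - 1) ^ k - (-1) ^ k * Z) * (v * r - 1) + Z * v * (r * (-1) ^ k) \<in> K"
      using Suc K_mult_right step4 K_add unfolding equ_def by blast
    then show ?case unfolding equ_def by (simp add: algebra_simps)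
  qed simp
  have step6: "Z \<asymp> ?P ^ B * y j ^ (m * (p - 1))"
  proof -
    have "v ^ (p - 1) - (y j ^ m) ^ (p - 1) =
        ?P * (y j * s * (\<Sum>i<p - 1. (y j ^ m) ^ (p - 1 - Suc i) * v ^ i))"
      unfolding power_diff_sumr2 by (simp add: s mult_ac)
    then have "Z - ?P ^ B * y j ^ (m * (p - 1)) =
        ?P ^ B * (?P * (y j * s * (\<Sum>i<p - 1. (y j ^ m) ^ (p - 1 - Suc i) * v ^ i)))"
      unfolding Z_def power_mult right_diff_distrib[symmetric] by simp
    also have "\<dots> = ?P ^ \<beta> * (y j * s * (\<Sum>i<p - 1. (y j ^ m) ^ (p - 1 - Suc i) * v ^ i))"
      using assms(3) by (simp add: B_def power_eq_if mult_ac)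
    finally show ?thesis unfolding equ_def by (simp add: char_ge)
  qed
  have "y j ^ (q - 1 + B * w) * Y \<asymp> y j ^ (m - 1) * v ^ M * Y"
    using step1 by (rule equ_sym)
  also have "\<dots> \<asymp> y j ^ (m - 1) * (?P ^ B * v ^ (p - 1) * (v * r - 1) ^ B) * Y"
    unfolding M_def by (intro equ_mult_left equ_mult_right step3)
  also have "\<dots> = y j ^ (m - 1) * (Z * (v * r - 1) ^ B) * Y" by (simp add: Z_def)
  also have "\<dots> \<asymp> y j ^ (m - 1) * ((-1) ^ B * Z) * Y"
    by (intro equ_mult_left equ_mult_right step5)
  also have "\<dots> \<asymp> y j ^ (m - 1) * ((-1) ^ B * (?P ^ B * y j ^ (m * (p - 1)))) * Y"
    by (intro equ_mult_left equ_mult_right step6)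
  also have "\<dots> = (-1) ^ B * (?P ^ B * (y j ^ (m - 1 + m * (p - 1)) * Y))"
    by (simp add: power_add mult_ac)
  also have "m - 1 + m * (p - 1) = q - 1"
    using m1 p2 by (simp add: q algebra_simps)
  also have "y j ^ (q - 1) * Y = (\<Prod>i\<in>J. y i ^ (p ^ \<alpha> i - 1))"
    unfolding q_def Y_def by (rule prod.remove[OF finite_J assms(1), symmetric])
  finally show ?thesis unfolding q_def B_def Y_def .
qed

lemma norm_element_equ:
  assumes "\<beta> \<ge> 1"
  shows "of_nat p ^ (\<beta> - 1) * (\<Prod>j\<in>J. \<Sum>i<p ^ \<alpha> j. (1 + y j) ^ i) \<asymp>
    of_nat p ^ (\<beta> - 1) * (\<Prod>j\<in>J. y j ^ (p ^ \<alpha> j - 1))"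
proof -
  have "\<exists>t. (\<Prod>j\<in>J. \<Sum>i<p ^ \<alpha> j. (1 + y j) ^ i) = (\<Prod>j\<in>J. y j ^ (p ^ \<alpha> j - 1)) + of_nat p * t"
    using finite_J
  proof (induction J)
    case (insert j J)
    then obtain t where t: "(\<Prod>j\<in>J. \<Sum>i<p ^ \<alpha> j. (1 + y j) ^ i) =
        (\<Prod>j\<in>J. y j ^ (p ^ \<alpha> j - 1)) + of_nat p * t" by blast
    obtain t' where t': "(\<Sum>i<p ^ \<alpha> j. (1 + y j) ^ i) = y j ^ (p ^ \<alpha> j - 1) + of_nat p * t'"
      using norm_element_eq_power[OF prime] by blast
    have "(\<Prod>j\<in>insert j J. \<Sum>i<p ^ \<alpha> j. (1 + y j) ^ i) =
        (y j ^ (p ^ \<alpha> j - 1) + of_nat p * t') * ((\<Prod>j\<in>J. y j ^ (p ^ \<alpha> j - 1)) + of_nat p * t)"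
      using insert by (simp add: t t')
    also have "\<dots> = (\<Prod>j\<in>insert j J. y j ^ (p ^ \<alpha> j - 1)) + of_nat p *
        (y j ^ (p ^ \<alpha> j - 1) * t + t' * ((\<Prod>j\<in>J. y j ^ (p ^ \<alpha> j - 1)) + of_nat p * t))"
      using insert by (simp add: algebra_simps)
    finally show ?case by blast
  qed (auto intro: exI[of _ 0])
  then obtain t where t: "(\<Prod>j\<in>J. \<Sum>i<p ^ \<alpha> j. (1 + y j) ^ i) =
      (\<Prod>j\<in>J. y j ^ (p ^ \<alpha> j - 1)) + of_nat p * t" by blast
  have "of_nat p ^ \<beta> * t \<in> K" by (rule char_ge) simp
  also have "of_nat p ^ \<beta> * t = of_nat p ^ (\<beta> - 1) * (of_nat p * t)"
    using assms by (simp add: power_eq_if mult_ac)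
  finally show ?thesis unfolding equ_def t by (simp add: algebra_simps)
qed

end

section \<open>Powers of a finitely generated ideal\<close>

text \<open>
  This is the \<open>m\<close>-th power of the ideal generated by the \<open>y j\<close>, presented through the monomials of
  degree \<open>m\<close>.
\<close>

inductive_set generated_power :: "'i set \<Rightarrow> ('i \<Rightarrow> 'a::comm_ring_1) \<Rightarrow> nat \<Rightarrow> 'a set"
  for J y m where
    zero: "0 \<in> generated_power J y m"
  | monomial: "(\<Sum>j\<in>J. e j) = m \<Longrightarrow> r * (\<Prod>j\<in>J. y j ^ e j) \<in> generated_power J y m"
  | add: "f \<in> generated_power J y m \<Longrightarrow> h \<in> generated_power J y m \<Longrightarrow> f + h \<in> generated_power J y m"

lemma generated_power_sum:
  "(\<And>i. i \<in> B \<Longrightarrow> f i \<in> generated_power J y m) \<Longrightarrow> sum f B \<in> generated_power J y m"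
  by (induction B rule: infinite_finite_induct) (auto intro: generated_power.zero generated_power.add)

lemma generated_power_0: "r \<in> generated_power J y 0"
  using generated_power.monomial[of "\<lambda>_. 0" J 0 r y] by simp

lemma generated_power_generator:
  assumes "finite J" "j \<in> J"
  shows "r * y j \<in> generated_power J y 1"
proof -
  let ?e = "\<lambda>i. if i = j then 1 else (0::nat)"
  have "(\<Prod>i\<in>J. y i ^ ?e i) = (\<Prod>i\<in>J. if i = j then y i else 1)" by (rule prod.cong) auto
  also have "\<dots> = y j" using assms by simp
  finally show ?thesis using generated_power.monomial[of ?e J 1 r y] assms by simp
qed

lemma generated_power_mult:
  assumes "f \<in> generated_power J y m" "h \<in> generated_power J y k"
  shows "f * h \<in> generated_power J y (m + k)"
  using assms(1)
proof induction
  case (monomial e r)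
  show ?case using assms(2)
  proof induction
    case (monomial e' r')
    have "r * r' * (\<Prod>j\<in>J. y j ^ (e j + e' j)) \<in> generated_power J y (m + k)"
      using monomial \<open>(\<Sum>j\<in>J. e j) = m\<close> by (intro generated_power.monomial) (simp add: sum.distrib)
    then show ?case by (simp add: power_add prod.distrib mult_ac)
  qed (auto simp: distrib_left intro: generated_power.intros)
qed (auto simp: distrib_right intro: generated_power.intros)

lemma generated_power_subset:
  assumes "ring_congruence K" "\<And>e. (\<Sum>j\<in>J. e j) = m \<Longrightarrow> (\<Prod>j\<in>J. y j ^ e j) \<in> K"
    and "f \<in> generated_power J y m"
  shows "f \<in> K"
  using assms(3)
  by induction (auto intro: assms(2) ring_congruence.K_zero[OF assms(1)]
      ring_congruence.K_add[OF assms(1)] ring_congruence.K_mult[OF assms(1)])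

lemma prod_power_minus_1:
  fixes x :: "'i \<Rightarrow> 'a::comm_ring_1"
  assumes "finite J"
  shows "(\<Prod>j\<in>J. x j ^ g j) - 1 \<in> generated_power J (\<lambda>j. x j - 1) 1"
proof -
  let ?F = "generated_power J (\<lambda>j. x j - 1) 1"
  have pow: "x j ^ k - 1 \<in> ?F" if "j \<in> J" for j k
    using generated_power_generator[OF assms that, of "\<Sum>i<k. x j ^ i" "\<lambda>j. x j - 1"]
    by (simp add: power_diff_1_eq mult.commute)
  have "(\<Prod>j\<in>B. x j ^ g j) - 1 \<in> ?F" if "B \<subseteq> J" for B
    using finite_subset[OF that assms] that
  proof (induction B)
    case (insert j B)
    have "x j ^ g j * ((\<Prod>j\<in>B. x j ^ g j) - 1) \<in> generated_power J (\<lambda>j. x j - 1) (0 + 1)"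
      using insert by (intro generated_power_mult generated_power_0) auto
    then have "x j ^ g j * ((\<Prod>j\<in>B. x j ^ g j) - 1) + (x j ^ g j - 1) \<in> ?F"
      using pow insert by (intro generated_power.add) auto
    then show ?case using insert by (simp add: algebra_simps)
  qed (simp add: generated_power.zero)
  then show ?thesis by simp
qed

section \<open>Integral group rings over a cover of the group\<close>

abbreviation "single \<equiv> Poly_Mapping.single"

text \<open>
  The pairing extends a function on the monoid linearly to its integral monoid ring. Coefficients and
  augmentation are both of this form, so \<open>pairing_mult\<close> is the only computation with products of
  finitely supported functions that is needed.
\<close>

definition pairing :: "('g \<Rightarrow> int) \<Rightarrow> ('g \<Rightarrow>\<^sub>0 int) \<Rightarrow> int"
  where "pairing \<phi> f = (\<Sum>g\<in>Poly_Mapping.keys f. Poly_Mapping.lookup f g * \<phi> g)"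

lemma pairing_0 [simp]: "pairing \<phi> 0 = 0"
  by (simp add: pairing_def)

lemma pairing_single [simp]: "pairing \<phi> (single g c) = c * \<phi> g"
  by (cases "c = 0") (simp_all add: pairing_def)

lemma pairing_add: "pairing \<phi> (f + h) = pairing \<phi> f + pairing \<phi> h"
  unfolding pairing_def
  by (rule setsum_keys_plus_distrib[of "\<lambda>g c. c * \<phi> g"]) (simp_all add: distrib_right)

lemma pairing_diff: "pairing \<phi> (f - h) = pairing \<phi> f - pairing \<phi> h"
  using pairing_add[of \<phi> "f - h" h] by simp

lemma pairing_sum: "pairing \<phi> (sum f B) = (\<Sum>i\<in>B. pairing \<phi> (f i))"
  by (induction B rule: infinite_finite_induct) (simp_all add: pairing_add)

lemma pairing_scale_left: "pairing (\<lambda>g. c * \<phi> g) f = c * pairing \<phi> f"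
  by (simp add: pairing_def sum_distrib_left mult_ac)

lemma pairing_sum_left: "pairing (\<lambda>g. \<Sum>i\<in>B. \<phi> i g) f = (\<Sum>i\<in>B. pairing (\<phi> i) f)"
  unfolding pairing_def sum_distrib_left by (rule sum.swap)

lemma pairing_mult:
  fixes f h :: "'g::comm_monoid_add \<Rightarrow>\<^sub>0 int"
  shows "pairing \<phi> (f * h) = pairing (\<lambda>g. pairing (\<lambda>k. \<phi> (g + k)) h) f"
proof (rule frag_induction[of f UNIV])
  fix g :: 'g
  show "pairing \<phi> (frag_of g * h) = pairing (\<lambda>g. pairing (\<lambda>k. \<phi> (g + k)) h) (frag_of g)"
    by (rule frag_induction[of h UNIV])
      (simp_all add: mult_single pairing_diff right_diff_distrib)
qed (simp_all add: pairing_diff left_diff_distrib)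

lemma pairing_of_int_mult:
  fixes f :: "'g::comm_monoid_add \<Rightarrow>\<^sub>0 int"
  shows "pairing \<phi> (of_int c * f) = c * pairing \<phi> f"
  by (subst single_of_int[symmetric], subst pairing_mult) simp

lemma residue_ring_finsum:
  assumes "M > 1" "finite B" "\<And>i. i \<in> B \<Longrightarrow> f i \<in> {0..<M}"
  shows "(\<Oplus>\<^bsub>residue_ring M\<^esub> i\<in>B. f i) = (\<Sum>i\<in>B. f i) mod M"
proof -
  interpret residues M "residue_ring M" using assms(1) by unfold_locales
  show ?thesis using assms(2,3)
  proof (induction B)
    case empty
    then show ?case by (simp add: res_zero_eq)
  next
    case (insert i B)
    then have "f \<in> B \<rightarrow> carrier (residue_ring M)" "f i \<in> carrier (residue_ring M)"
      by (auto simp: res_carrier_eq)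
    then show ?case using insert by (simp add: finsum_insert res_add_eq mod_simps)
  qed
qed

text \<open>
  A homomorphism \<open>\<rho>\<close> from a commutative monoid to \<open>A\<close> induces a ring homomorphism \<open>pr\<close> from the integral
  monoid ring to the group ring of \<open>A\<close>. The point is to compute in a ring that is a type-class
  instance, even though \<open>A\<close> and its group ring depend on parameters and live on carrier sets.
\<close>

locale group_ring_cover =
  fixes M :: int and A :: "('a, 'm) monoid_scheme" and \<rho> :: "'g::comm_monoid_add \<Rightarrow> 'a"
  assumes M: "M > 1"
    and comm_group_A: "comm_group A"
    and finite_A: "finite (carrier A)"
    and rho_closed: "\<rho> g \<in> carrier A"
    and rho_add: "\<rho> (g + k) = \<rho> g \<otimes>\<^bsub>A\<^esub> \<rho> k"
begin

interpretation A: comm_group A by (rule comm_group_A)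

abbreviation "S \<equiv> group_ring (residue_ring M) A"
abbreviation "I \<equiv> augmentation_ideal (residue_ring M) A"

definition coeff_sum :: "('g \<Rightarrow>\<^sub>0 int) \<Rightarrow> 'a \<Rightarrow> int"
  where "coeff_sum f a = pairing (\<lambda>g. of_bool (\<rho> g = a)) f"

definition pr :: "('g \<Rightarrow>\<^sub>0 int) \<Rightarrow> 'a \<Rightarrow> int"
  where "pr f = (\<lambda>a\<in>carrier A. coeff_sum f a mod M)"

lemma residue_simps:
  "carrier (residue_ring M) = {0..M - 1}" "x \<otimes>\<^bsub>residue_ring M\<^esub> z = (x * z) mod M"
  "x \<oplus>\<^bsub>residue_ring M\<^esub> z = (x + z) mod M" "\<zero>\<^bsub>residue_ring M\<^esub> = 0"
  by (simp_all add: residue_ring_def)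

lemma pairing_rho: "pairing (\<lambda>g. \<psi> (\<rho> g)) f = (\<Sum>a\<in>carrier A. coeff_sum f a * \<psi> a)"
proof -
  have "(\<lambda>g. \<psi> (\<rho> g)) = (\<lambda>g. \<Sum>a\<in>carrier A. \<psi> a * of_bool (\<rho> g = a))"
    using rho_closed finite_A by (simp add: fun_eq_iff)
  then show ?thesis
    by (simp add: pairing_sum_left pairing_scale_left coeff_sum_def mult.commute)
qed

lemma coeff_sum_mult:
  assumes "a \<in> carrier A"
  shows "coeff_sum (f * h) a = (\<Sum>x\<in>carrier A. coeff_sum f x * coeff_sum h (inv\<^bsub>A\<^esub> x \<otimes>\<^bsub>A\<^esub> a))"
proof -
  have "\<rho> (g + k) = a \<longleftrightarrow> \<rho> k = inv\<^bsub>A\<^esub> \<rho> g \<otimes>\<^bsub>A\<^esub> a" for g k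
    using assms rho_closed A.inv_solve_left[of "\<rho> k" "\<rho> g" a] by (auto simp: rho_add)
  then have "coeff_sum (f * h) a = pairing (\<lambda>g. coeff_sum h (inv\<^bsub>A\<^esub> \<rho> g \<otimes>\<^bsub>A\<^esub> a)) f"
    by (simp add: coeff_sum_def pairing_mult)
  then show ?thesis by (simp only: pairing_rho[of "\<lambda>x. coeff_sum h (inv\<^bsub>A\<^esub> x \<otimes>\<^bsub>A\<^esub> a)"])
qed

lemma pr_eq_iff: "pr f = pr h \<longleftrightarrow> (\<forall>a\<in>carrier A. M dvd coeff_sum f a - coeff_sum h a)"
  by (auto simp: pr_def fun_eq_iff mod_eq_dvd_iff restrict_def)

lemma pr_closed: "pr f \<in> carrier S"
  using M finite_A by (auto simp: group_ring_def pr_def residue_simps gr_support_def)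

lemma pr_zero: "pr 0 = \<zero>\<^bsub>S\<^esub>"
  by (simp add: group_ring_def pr_def coeff_sum_def residue_simps)

lemma pr_add: "pr (f + h) = pr f \<oplus>\<^bsub>S\<^esub> pr h"
  by (auto simp: group_ring_def pr_def coeff_sum_def pairing_add residue_simps mod_simps)

lemma sum_gr_support:
  "(\<Sum>x\<in>gr_support (residue_ring M) A (pr f). pr f x * \<psi> x) = (\<Sum>x\<in>carrier A. pr f x * \<psi> x)"
  by (rule sum.mono_neutral_left) (auto simp: finite_A gr_support_def residue_simps)

lemma finite_gr_support: "finite (gr_support (residue_ring M) A f)"
  using finite_A by (simp add: gr_support_def)

lemma pr_mult: "pr (f * h) = pr f \<otimes>\<^bsub>S\<^esub> pr h"
proof
  fix a
  show "pr (f * h) a = (pr f \<otimes>\<^bsub>S\<^esub> pr h) a"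
  proof (cases "a \<in> carrier A")
    case True
    let ?u = "\<lambda>x. inv\<^bsub>A\<^esub> x \<otimes>\<^bsub>A\<^esub> a"
    have "(pr f \<otimes>\<^bsub>S\<^esub> pr h) a = (\<Sum>x\<in>gr_support (residue_ring M) A (pr f). (pr f x * pr h (?u x)) mod M) mod M"
      using True M by (simp add: group_ring_def residue_simps residue_ring_finsum finite_gr_support)
    also have "\<dots> = (\<Sum>x\<in>carrier A. pr f x * pr h (?u x)) mod M"
      by (simp add: mod_sum_eq sum_gr_support)
    also have "\<dots> = (\<Sum>x\<in>carrier A. (pr f x * pr h (?u x)) mod M) mod M"
      by (simp add: mod_sum_eq)
    also have "\<dots> = (\<Sum>x\<in>carrier A. (coeff_sum f x * coeff_sum h (?u x)) mod M) mod M"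
      using True by (simp add: pr_def mod_simps)
    also have "\<dots> = pr (f * h) a"
      using True by (simp add: mod_sum_eq pr_def coeff_sum_mult)
    finally show ?thesis by simp
  qed (simp add: group_ring_def pr_def)
qed

lemma augmentation_pr: "augmentation (residue_ring M) A (pr f) = pairing (\<lambda>_. 1) f mod M"
proof -
  have "pr f x \<in> {0..<M}" if "x \<in> carrier A" for x
    using M that by (simp add: pr_def)
  then have "augmentation (residue_ring M) A (pr f)
      = (\<Sum>x\<in>gr_support (residue_ring M) A (pr f). pr f x * 1) mod M"
    unfolding augmentation_def using M
    by (subst residue_ring_finsum[OF M finite_gr_support]) (auto simp: gr_support_def)
  also have "\<dots> = (\<Sum>x\<in>carrier A. coeff_sum f x mod M) mod M"
    unfolding sum_gr_support by (simp add: pr_def)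
  also have "\<dots> = (\<Sum>x\<in>carrier A. coeff_sum f x * 1) mod M"
    by (simp add: mod_sum_eq)
  finally show ?thesis by (simp only: pairing_rho[of "\<lambda>_. 1"])
qed

lemma augmentation_ideal_iff:
  "x \<in> I \<longleftrightarrow> x \<in> carrier S \<and> augmentation (residue_ring M) A x = 0"
  by (simp add: augmentation_ideal_def a_kernel_def kernel_def residue_simps)

lemma pr_in_augmentation_ideal: "pr f \<in> I \<longleftrightarrow> M dvd pairing (\<lambda>_. 1) f"
  by (auto simp: augmentation_ideal_iff pr_closed augmentation_pr)

lemma pr_surj:
  assumes rep: "\<And>a. a \<in> carrier A \<Longrightarrow> \<rho> (rep a) = a" and x: "x \<in> carrier S"
  shows "pr (\<Sum>a\<in>carrier A. single (rep a) (x a)) = x"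
proof
  fix b
  have "coeff_sum (\<Sum>a\<in>carrier A. single (rep a) (x a)) b = (\<Sum>a\<in>carrier A. x a * of_bool (a = b))"
    by (simp add: coeff_sum_def pairing_sum rep)
  also have "\<dots> = x b" if "b \<in> carrier A"
    using that finite_A by simp
  finally show "pr (\<Sum>a\<in>carrier A. single (rep a) (x a)) b = x b"
    using x by (auto simp: pr_def group_ring_def residue_simps PiE_iff extensional_def)
qed

text \<open>
  If the coefficients of \<open>x\<close> have sum zero modulo \<open>M\<close>, subtracting this sum from a preimage of \<open>x\<close> does not
  change its image; this is why the elements \<open>g - 1\<close> span the augmentation ideal.
\<close>

lemma augmentation_ideal_representation:
  assumes rep: "\<And>a. a \<in> carrier A \<Longrightarrow> \<rho> (rep a) = a" and x: "x \<in> I"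
  shows "pr (\<Sum>a\<in>carrier A. of_int (x a) * (single (rep a) 1 - 1)) = x"
proof -
  let ?f = "\<Sum>a\<in>carrier A. single (rep a) (x a)"
  have x': "x \<in> carrier S" "augmentation (residue_ring M) A x = 0"
    using x by (simp_all add: augmentation_ideal_iff)
  have "(\<Sum>a\<in>carrier A. x a) = pairing (\<lambda>_. 1) ?f" by (simp add: pairing_sum)
  then have dvd: "M dvd (\<Sum>a\<in>carrier A. x a)"
    using augmentation_pr[of ?f] x' pr_surj[of rep x] rep by auto
  have "of_int c * single g 1 = single g c" for c and g :: 'g
    by (metis add_0 mult.right_neutral mult_single single_of_int of_int_eq_id id_apply)
  then have "(\<Sum>a\<in>carrier A. of_int (x a) * (single (rep a) 1 - 1)) = ?f - of_int (\<Sum>a\<in>carrier A. x a) * 1"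
    by (simp add: right_diff_distrib sum_subtractf)
  moreover have "M dvd pairing \<phi> (of_int (\<Sum>a\<in>carrier A. x a) * 1)" for \<phi> :: "'g \<Rightarrow> int"
    unfolding pairing_of_int_mult using dvd by (rule dvd_mult2)
  ultimately have "pr (\<Sum>a\<in>carrier A. of_int (x a) * (single (rep a) 1 - 1)) = pr ?f"
    unfolding pr_eq_iff coeff_sum_def by (simp only: pairing_diff) simp
  then show ?thesis using pr_surj[of rep x] rep x' by simp
qed

definition Ker :: "('g \<Rightarrow>\<^sub>0 int) set"
  where "Ker = {f. pr f = \<zero>\<^bsub>S\<^esub>}"

lemma Ker_iff: "f \<in> Ker \<longleftrightarrow> (\<forall>a\<in>carrier A. M dvd coeff_sum f a)"
  unfolding Ker_def pr_zero[symmetric] using pr_eq_iff[of f 0] by (simp add: coeff_sum_def)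

lemma ring_congruence_Ker: "ring_congruence Ker"
proof
  show "x * f \<in> Ker" if "f \<in> Ker" for x f
    using that unfolding Ker_iff by (auto simp: coeff_sum_mult intro!: dvd_sum)
qed (auto simp: Ker_iff coeff_sum_def pairing_add)

lemma of_int_in_Ker: "of_int M \<in> Ker"
  using pairing_of_int_mult[of _ M "1 :: 'g \<Rightarrow>\<^sub>0 int"] by (simp add: Ker_iff coeff_sum_def)

lemma single_diff_in_Ker: "\<rho> g = \<rho> k \<Longrightarrow> single g c - single k c \<in> Ker"
  by (simp add: Ker_iff coeff_sum_def pairing_diff)

text \<open>
  The powers of \<open>I\<close> are the images of the powers of the ideal generated by the \<open>y j\<close>. For minimality, a
  monomial of degree at least \<open>m\<close> has its image in the \<open>m\<close>-th power of \<open>I\<close>, so one nonzero monomial of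
  degree \<open>N\<close> excludes all \<open>m \<le> N\<close> at once.
\<close>

lemma nilpotency_degree_by_monomials:
  assumes "finite J"
    and gen: "\<And>j. j \<in> J \<Longrightarrow> pr (y j) \<in> I"
    and span: "\<And>x. x \<in> I \<Longrightarrow> \<exists>f\<in>generated_power J y 1. pr f = x"
    and surj: "\<And>x. x \<in> carrier S \<Longrightarrow> \<exists>f. pr f = x"
    and vanish: "\<And>e. (\<Sum>j\<in>J. e j) = Suc N \<Longrightarrow> (\<Prod>j\<in>J. y j ^ e j) \<in> Ker"
    and nonzero: "(\<Sum>j\<in>J. e j) = N" "(\<Prod>j\<in>J. y j ^ e j) \<notin> Ker"
  shows "is_nilpotency_degree S I (Suc N)"
proof -
  let ?pow = "\<lambda>m::nat. I [^]\<^bsub>ideals_set S\<^esub> m"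
  have pow_0: "?pow 0 = carrier S" and pow_Suc: "?pow (Suc m) = ideal_prod S (?pow m) I" for m
    by (simp_all add: nat_pow_def ideals_set_def)
  have upper: "x \<in> ?pow m \<Longrightarrow> \<exists>f\<in>generated_power J y m. pr f = x" for x m
  proof (induction m arbitrary: x)
    case 0
    then show ?case using surj generated_power_0 by (metis pow_0)
  next
    case (Suc m)
    from Suc.prems show ?case unfolding pow_Suc
    proof induction
      case (prod i j)
      then obtain f h where "f \<in> generated_power J y m" "h \<in> generated_power J y 1" "pr f = i" "pr h = j"
        using Suc.IH span by blast
      then show ?case using generated_power_mult[of f J y m h 1] by (auto simp: pr_mult[symmetric])
    next
      case (sum s1 s2)
      then show ?case using generated_power.add by (fastforce simp: pr_add[symmetric])
    qed
  qed
  have lower: "m \<le> (\<Sum>j\<in>J. e j) \<Longrightarrow> pr (r * (\<Prod>j\<in>J. y j ^ e j)) \<in> ?pow m" for m e r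
  proof (induction m arbitrary: e)
    case 0
    show ?case unfolding pow_0 by (rule pr_closed)
  next
    case (Suc m)
    then have "(\<Sum>j\<in>J. e j) \<noteq> 0" by simp
    then obtain j where j: "j \<in> J" "e j \<noteq> 0" by (meson sum.neutral)
    let ?e = "e(j := e j - 1)"
    have rest: "(\<Sum>i\<in>J - {j}. ?e i) = (\<Sum>i\<in>J - {j}. e i)"
      "(\<Prod>i\<in>J - {j}. y i ^ ?e i) = (\<Prod>i\<in>J - {j}. y i ^ e i)"
      by (auto intro!: sum.cong prod.cong)
    have "(\<Sum>j\<in>J. e j) = Suc (\<Sum>j\<in>J. ?e j)"
      unfolding sum.remove[OF \<open>finite J\<close> j(1)] rest using j by simp
    then have "pr (r * (\<Prod>j\<in>J. y j ^ ?e j)) \<in> ?pow m" using Suc by simp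
    then have "pr (r * (\<Prod>j\<in>J. y j ^ ?e j)) \<otimes>\<^bsub>S\<^esub> pr (y j) \<in> ?pow (Suc m)"
      unfolding pow_Suc using gen[OF j(1)] by (rule ideal_prod.prod)
    moreover have "r * (\<Prod>j\<in>J. y j ^ ?e j) * y j = r * (\<Prod>j\<in>J. y j ^ e j)"
      unfolding prod.remove[OF \<open>finite J\<close> j(1)] rest using j
      by (simp add: power_eq_if[of _ "e j"] mult_ac)
    ultimately show ?case by (simp add: pr_mult[symmetric])
  qed
  have zero_in: "\<zero>\<^bsub>S\<^esub> \<in> ?pow m" for m
  proof (induction m)
    case (Suc m)
    moreover have "\<zero>\<^bsub>S\<^esub> \<in> I" unfolding pr_zero[symmetric] by (simp add: pr_in_augmentation_ideal)
    ultimately have "\<zero>\<^bsub>S\<^esub> \<otimes>\<^bsub>S\<^esub> \<zero>\<^bsub>S\<^esub> \<in> ?pow (Suc m)" unfolding pow_Suc by (rule ideal_prod.prod)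
    then show ?case unfolding pr_zero[symmetric] pr_mult[symmetric] by simp
  qed (metis pow_0 pr_closed pr_zero)
  have "?pow (Suc N) = {\<zero>\<^bsub>S\<^esub>}"
    using zero_in upper[of _ "Suc N"] generated_power_subset[OF ring_congruence_Ker vanish]
    by (fastforce simp: Ker_def)
  moreover have "Suc N \<le> m" if "?pow m = {\<zero>\<^bsub>S\<^esub>}" for m
  proof (rule ccontr)
    assume "\<not> Suc N \<le> m"
    then have "pr (1 * (\<Prod>j\<in>J. y j ^ e j)) \<in> ?pow m" using nonzero(1) by (intro lower) simp
    then show False using that nonzero(2) by (simp add: Ker_def)
  qed
  ultimately show ?thesis by (simp add: is_nilpotency_degree_def)
qed

end

section \<open>Products of cyclic groups\<close>

locale cyclic_product =
  fixes J :: "'i set" and q :: "'i \<Rightarrow> nat" and M :: int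
  assumes finite_J: "finite J" and q_pos: "j \<in> J \<Longrightarrow> q j > 0" and M_gt_1: "M > 1"
begin

abbreviation "A \<equiv> product_group J (\<lambda>j. integer_mod_group (q j))"

definition residues_of :: "('i \<Rightarrow> nat) \<Rightarrow> 'i \<Rightarrow> int"
  where "residues_of g = (\<lambda>j\<in>J. int (g j mod q j))"

lemma carrier_A: "carrier A = (\<Pi>\<^sub>E j\<in>J. {0..<int (q j)})"
  unfolding carrier_product_group
  by (rule PiE_cong) (use q_pos in \<open>force simp: carrier_integer_mod_group\<close>)

sublocale group_ring_cover M A residues_of
proof (rule group_ring_cover.intro)
  show "comm_group A"
    by (rule group.group_comm_groupI)
      (auto simp: PiE_iff intro!: restrict_ext simp: add.commute)
  show "finite (carrier A)" unfolding carrier_A using finite_J by (intro finite_PiE) auto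
  show "residues_of g \<in> carrier A" for g
    unfolding carrier_A using q_pos by (auto simp: residues_of_def)
  show "residues_of (g + k) = residues_of g \<otimes>\<^bsub>A\<^esub> residues_of k" for g k
    by (auto simp: residues_of_def fun_eq_iff restrict_def zmod_int mod_simps)
qed (rule M_gt_1)

text \<open>
  Elements of \<open>carrier A\<close> are undefined outside \<open>J\<close>; the representative is zero there, so that it is a
  product of powers of the variables indexed by \<open>J\<close>.
\<close>

definition rep :: "('i \<Rightarrow> int) \<Rightarrow> 'i \<Rightarrow> nat"
  where "rep a = (\<lambda>j. if j \<in> J then nat (a j) else 0)"

definition var :: "'i \<Rightarrow> ('i \<Rightarrow> nat) \<Rightarrow>\<^sub>0 int"
  where "var j = single (\<lambda>i. if i = j then 1 else 0) 1"

lemma residues_of_rep: "a \<in> carrier A \<Longrightarrow> residues_of (rep a) = a"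
  unfolding carrier_A
  by (rule ext) (auto simp: residues_of_def rep_def PiE_iff extensional_def zmod_int)

lemma var_power: "var j ^ k = single (\<lambda>i. if i = j then k else 0) 1"
proof (induction k)
  case 0
  then show ?case by (simp add: zero_fun_def[symmetric])
next
  case (Suc k)
  then show ?case by (auto simp: var_def mult_single intro!: arg_cong[of _ _ "\<lambda>g. single g 1"])
qed

lemma prod_var_power: "(\<Prod>j\<in>J. var j ^ g j) = single (\<lambda>j. if j \<in> J then g j else 0) 1"
  using finite_J
proof (induction J)
  case empty
  then show ?case by (simp add: zero_fun_def[symmetric])
next
  case (insert j J)
  then show ?case
    by (auto simp: var_power mult_single intro!: arg_cong[of _ _ "\<lambda>g. single g 1"])
qed

lemma order_var: "j \<in> J \<Longrightarrow> var j ^ q j - 1 \<in> Ker"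
  using single_diff_in_Ker[of "\<lambda>i. if i = j then q j else 0" 0 1]
  by (auto simp: var_power residues_of_def fun_eq_iff restrict_def)

lemma var_generates:
  "pr (var j - 1) \<in> I"
  "x \<in> I \<Longrightarrow> \<exists>f\<in>generated_power J (\<lambda>j. var j - 1) 1. pr f = x"
  "x \<in> carrier S \<Longrightarrow> \<exists>f. pr f = x"
proof -
  have "pairing (\<lambda>_. 1) (1 :: ('i \<Rightarrow> nat) \<Rightarrow>\<^sub>0 int) = 1"
    using pairing_single[of "\<lambda>_. 1" 0 1] by simp
  then show "pr (var j - 1) \<in> I"
    by (simp add: pr_in_augmentation_ideal pairing_diff var_def)
  show "\<exists>f. pr f = x" if "x \<in> carrier S"
    using pr_surj[OF residues_of_rep that] by blast
  show "\<exists>f\<in>generated_power J (\<lambda>j. var j - 1) 1. pr f = x" if "x \<in> I"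
  proof
    show "pr (\<Sum>a\<in>carrier A. of_int (x a) * (single (rep a) 1 - 1)) = x"
      by (rule augmentation_ideal_representation[OF residues_of_rep that])
    have "of_int (x a) * (single (rep a) 1 - 1) \<in> generated_power J (\<lambda>j. var j - 1) (0 + 1)" for a
    proof (intro generated_power_mult generated_power_0)
      have "single (rep a) 1 = (\<Prod>j\<in>J. var j ^ rep a j)"
        unfolding prod_var_power by (rule arg_cong[of _ _ "\<lambda>g. single g 1"]) (auto simp: rep_def)
      then show "single (rep a) 1 - 1 \<in> generated_power J (\<lambda>j. var j - 1) 1"
        using prod_power_minus_1[OF finite_J, of var] by simp
    qed
    then show "(\<Sum>a\<in>carrier A. of_int (x a) * (single (rep a) 1 - 1)) \<in> generated_power J (\<lambda>j. var j - 1) 1"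
      by (intro generated_power_sum) simp
  qed
qed

text \<open>
  The product expands to the sum of all group elements, each occurring once. Looking at the
  coefficient of the neutral element suffices.
\<close>

lemma norm_element_not_in_Ker:
  assumes "\<not> M dvd c"
  shows "of_int c * (\<Prod>j\<in>J. \<Sum>i<q j. var j ^ i) \<notin> Ker"
proof -
  let ?E = "\<Pi>\<^sub>E j\<in>J. {..<q j}" and ?z = "\<lambda>g j. if j \<in> J then g j else (0::nat)"
  let ?one = "\<lambda>j\<in>J. 0 :: int"
  have "(\<Prod>j\<in>J. \<Sum>i<q j. var j ^ i) = (\<Sum>g\<in>?E. single (?z g) 1)"
    using finite_J by (simp add: prod_sum_PiE prod_var_power)
  then have "coeff_sum (of_int c * (\<Prod>j\<in>J. \<Sum>i<q j. var j ^ i)) ?one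
      = c * (\<Sum>g\<in>?E. of_bool (residues_of (?z g) = ?one))"
    by (simp add: coeff_sum_def pairing_of_int_mult pairing_sum)
  also have "(\<Sum>g\<in>?E. of_bool (residues_of (?z g) = ?one)) = (\<Sum>g\<in>?E. of_bool (g = (\<lambda>j\<in>J. 0)) :: int)"
  proof (rule sum.cong[OF refl], rule arg_cong[of _ _ of_bool])
    fix g assume g: "g \<in> ?E"
    have "residues_of (?z g) = ?one \<longleftrightarrow> (\<forall>j\<in>J. g j = 0)"
      using g by (auto simp: residues_of_def fun_eq_iff restrict_def PiE_iff)
    also have "\<dots> \<longleftrightarrow> g = (\<lambda>j\<in>J. 0)"
      using g by (auto simp: fun_eq_iff restrict_def PiE_iff extensional_def)
    finally show "(residues_of (?z g) = ?one) = (g = (\<lambda>j\<in>J. 0))" .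
  qed
  also have "\<dots> = 1"
    using finite_J q_pos by (simp add: finite_PiE)
  finally have coeff: "coeff_sum (of_int c * (\<Prod>j\<in>J. \<Sum>i<q j. var j ^ i)) ?one = c"
    by (simp only: mult_1_right)
  have "\<not> M dvd coeff_sum (of_int c * (\<Prod>j\<in>J. \<Sum>i<q j. var j ^ i)) ?one"
    unfolding coeff by (rule assms)
  moreover have "?one \<in> carrier A" unfolding carrier_A using q_pos by auto
  ultimately show ?thesis unfolding Ker_iff by blast
qed

end

section \<open>The nilpotency degree\<close>

theorem mainTheorem3:
  fixes p n \<beta> :: nat and \<alpha> :: "nat \<Rightarrow> nat"
  assumes "Factorial_Ring.prime p" and "n \<ge> 1"
    and "\<And>j. j \<in> {1..n} \<Longrightarrow> \<alpha> j \<ge> 1" and "\<beta> \<ge> 1"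
  defines "R \<equiv> residue_ring (int (p ^ \<beta>))"
    and "A \<equiv> product_group {1..n} (\<lambda>j. integer_mod_group (p ^ \<alpha> j))"
    and "\<alpha>max \<equiv> Max (\<alpha> ` {1..n})"
  shows "is_nilpotency_degree (group_ring R A) (augmentation_ideal R A)
    ((\<Sum>j=1..n. p ^ \<alpha> j) - n + 1 + (\<beta> - 1) * (p - 1) * p ^ (\<alpha>max - 1))"
proof -
  define w where "w = (p - 1) * p ^ (\<alpha>max - 1)"
  define N where "N = (\<Sum>j\<in>{1..n}. p ^ \<alpha> j - 1) + (\<beta> - 1) * w"
  have p2: "p \<ge> 2" using assms(1) by (rule prime_ge_2_nat)
  interpret C: cyclic_product "{1..n}" "\<lambda>j. p ^ \<alpha> j" "int (p ^ \<beta>)"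
    using p2 assms(4) by unfold_locales auto
  let ?y = "\<lambda>j. C.var j - 1"
  interpret P: prime_power_relations C.Ker p \<beta> w "{1..n}" \<alpha> ?y
  proof (intro prime_power_relations.intro prime_power_relations_axioms.intro C.ring_congruence_Ker assms(1))
    show "of_nat p ^ \<beta> \<in> C.Ker" using C.of_int_in_Ker by simp
    show "ring_congruence.equ C.Ker ((1 + ?y j) ^ p ^ \<alpha> j) 1" if "j \<in> {1..n}" for j
    proof -
      have "1 + ?y j = C.var j" by simp
      then show ?thesis
        unfolding ring_congruence.equ_def[OF C.ring_congruence_Ker] using C.order_var[OF that] by simp
    qed
    show "(p - 1) * p ^ (\<alpha> j - 1) \<le> w" if "j \<in> {1..n}" for j
    proof -
      have "\<alpha> j \<le> \<alpha>max" using that by (simp add: \<alpha>max_def)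
      then show ?thesis using p2 unfolding w_def by (intro mult_left_mono power_increasing) auto
    qed
  qed simp
  have "\<alpha>max \<in> \<alpha> ` {1..n}" unfolding \<alpha>max_def using assms(2) by (intro Max_in) auto
  then obtain j0 where j0: "j0 \<in> {1..n}" "\<alpha> j0 = \<alpha>max" by auto
  \<comment> \<open>The excess degree goes to a factor of largest exponent, where \<open>w\<close> is the exact weight of \<open>p\<close>.\<close>
  define e where "e = (\<lambda>j. p ^ \<alpha> j - 1)(j0 := p ^ \<alpha> j0 - 1 + (\<beta> - 1) * w)"
  have "(\<Prod>j\<in>{1..n}. ?y j ^ e j) \<notin> C.Ker"
  proof
    let ?Z = "of_nat p ^ (\<beta> - 1) * (\<Prod>j\<in>{1..n}. ?y j ^ (p ^ \<alpha> j - 1))"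
    assume "(\<Prod>j\<in>{1..n}. ?y j ^ e j) \<in> C.Ker"
    then have "?y j0 ^ (p ^ \<alpha> j0 - 1 + (\<beta> - 1) * w) *
        (\<Prod>j\<in>{1..n} - {j0}. ?y j ^ (p ^ \<alpha> j - 1)) \<in> C.Ker"
      unfolding e_def P.prod_update(1)[OF j0(1)] .
    moreover have "w = (p - 1) * p ^ (\<alpha> j0 - 1)" by (simp only: w_def j0(2))
    ultimately have "(-1) ^ (\<beta> - 1) * ?Z \<in> C.Ker"
      using P.equ_K[OF P.leading_monomial_reduces[OF j0(1) assms(3)[OF j0(1)] assms(4)]] by blast
    then have "(-1) ^ (\<beta> - 1) * ((-1) ^ (\<beta> - 1) * ?Z) \<in> C.Ker" by (rule P.K_mult)
    then have "?Z \<in> C.Ker" by (simp add: mult.assoc[symmetric] power_mult_distrib[symmetric])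
    then have "of_nat p ^ (\<beta> - 1) * (\<Prod>j\<in>{1..n}. \<Sum>i<p ^ \<alpha> j. (1 + ?y j) ^ i) \<in> C.Ker"
      using P.equ_K[OF P.norm_element_equ[OF assms(4)]] by simp
    then have "of_int (int (p ^ (\<beta> - 1))) * (\<Prod>j\<in>{1..n}. \<Sum>i<p ^ \<alpha> j. C.var j ^ i) \<in> C.Ker" by simp
    moreover have "\<not> int (p ^ \<beta>) dvd int (p ^ (\<beta> - 1))"
      using p2 assms(4) unfolding int_dvd_int_iff by (intro nat_dvd_not_less) auto
    ultimately show False using C.norm_element_not_in_Ker by blast
  qed
  moreover have "(\<Sum>j\<in>{1..n}. e j) = N"
    unfolding e_def P.prod_update(2)[OF j0(1)] N_def sum.remove[OF finite_atLeastAtMost j0(1)] by simp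
  moreover have "(\<Prod>j\<in>{1..n}. ?y j ^ e j) \<in> C.Ker" if "(\<Sum>j\<in>{1..n}. e j) = Suc N" for e
    using P.monomial_vanishes[of 0 e] that by (simp add: N_def)
  ultimately have "is_nilpotency_degree C.S C.I (Suc N)"
    using C.var_generates by (intro C.nilpotency_degree_by_monomials[of "{1..n}" ?y]) auto
  moreover have "Suc N = (\<Sum>j=1..n. p ^ \<alpha> j) - n + 1 + (\<beta> - 1) * (p - 1) * p ^ (\<alpha>max - 1)"
    using p2 by (simp add: N_def w_def sum_subtractf_nat mult.assoc)
  ultimately show ?thesis unfolding R_def A_def by simp
qed

end
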